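(* Let $Z_0:=(L_0[0,+\infty))^{\mathbb{N}}$ be the set of all sequences of (classes of) Lebesgue measurable functions $[0,+\infty)\to\mathbb{R}$. The family of all sequences $(f_n)_n\in Z_0$ such that $(f_n)_n$ converges uniformly to $0$ on $[0,+\infty)$ but does not converge to $0$ in $L^1$-norm is strongly $\mathfrak{c}$-algebrable.
   Context: $L_0[0,+\infty)$ is the space of Lebesgue measurable functions $[0,+\infty)\to\mathbb{R}$, with functions equal a.e. identified; $Z_0$ is a commutative real algebra with coordinatewise operations (elements of $L_0[0,+\infty)$ being added, multiplied and scaled pointwise a.e.). For classes of functions, uniform convergence to $0$ is understood up to null sets, i.e. $\operatorname{ess\,sup}_{[0,+\infty)}|f_n|\to0$. For measurable $f$, $\|f\|_1=\int_0^{+\infty}|f(x)|\,dx\in[0,+\infty]$; $(f_n)_n$ converges to $0$ in $L^1$-norm if $\|f_n\|_1\to0$. $\mathfrak{c}$ is the cardinality of the continuum. A subset $A$ of a commutative real algebra is strongly $\alpha$-algebrable ($\alpha$ a cardinal) if there is a free subalgebra $M$ (not required to be unital) generated by $\alpha$ free generators with $M\setminus\{0\}\subset A$. Equivalently, there is a set $B$ of cardinality $\alpha$, generating a subalgebra $M$ with $M\setminus\{0\}\subset A$, such that for every $s\in\mathbb{N}$, every nonzero real polynomial $P$ in $s$ variables without constant term, and every choice of distinct $f_1,\dots,f_s\in B$, one has $P(f_1,\dots,f_s)\ne 0$ (so that $P(f_1,\dots,f_s)\in M\setminus\{0\}\subset A$). *)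

theory Defs
  imports
    "HOL-Analysis.Analysis"
    "HOL-Probability.Essential_Supremum"
    "HOL-Library.Function_Algebras"
    "HOL-Library.Poly_Mapping"
begin

unbundle cardinal_syntax

section \<open>The algebra of classes of measurable functions on the half-line\<close>

abbreviation halfline :: "real measure" where
  "halfline \<equiv> lebesgue_on {0..}"

text \<open>
  A function on \<open>[0, \<infinity>)\<close> is represented by a total function on the reals; both measurability and
  the equivalence below ignore its values outside \<open>[0, \<infinity>)\<close>.
\<close>

definition eq_ae :: "(real \<Rightarrow> real) \<Rightarrow> (real \<Rightarrow> real) \<Rightarrow> bool" where
  "eq_ae f g \<longleftrightarrow> f \<in> borel_measurable halfline \<and> g \<in> borel_measurable halfline \<and>
     (AE x in halfline. f x = g x)"

quotient_type L0 = "real \<Rightarrow> real" / partial: eq_ae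
proof (rule part_equivpI)
  show "\<exists>f. eq_ae f f"
    by (rule exI[of _ "\<lambda>_. 0"]) (simp add: eq_ae_def)
  show "symp eq_ae"
    by (auto simp: symp_def eq_ae_def elim: AE_mp)
  show "transp eq_ae"
    unfolding transp_def eq_ae_def by (auto elim: AE_mp)
qed

instantiation L0 :: "{comm_ring_1, real_algebra_1}"
begin

lift_definition zero_L0 :: L0 is "\<lambda>_. 0"
  by (simp add: eq_ae_def)

lift_definition one_L0 :: L0 is "\<lambda>_. 1"
  by (simp add: eq_ae_def)

lift_definition plus_L0 :: "L0 \<Rightarrow> L0 \<Rightarrow> L0" is "\<lambda>f g x. f x + g x"
  by (auto simp: eq_ae_def)

lift_definition minus_L0 :: "L0 \<Rightarrow> L0 \<Rightarrow> L0" is "\<lambda>f g x. f x - g x"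
  by (auto simp: eq_ae_def)

lift_definition uminus_L0 :: "L0 \<Rightarrow> L0" is "\<lambda>f x. - f x"
  by (auto simp: eq_ae_def)

lift_definition times_L0 :: "L0 \<Rightarrow> L0 \<Rightarrow> L0" is "\<lambda>f g x. f x * g x"
  by (auto simp: eq_ae_def)

lift_definition scaleR_L0 :: "real \<Rightarrow> L0 \<Rightarrow> L0" is "\<lambda>c f x. c * f x"
  by (auto simp: eq_ae_def)

lemma not_AE_halfline_False: "\<not> (AE x in halfline. False)"
proof
  assume "AE x in halfline. False"
  then have "AE x in lebesgue. x \<notin> {0..1::real}"
    by (subst (asm) AE_restrict_space_iff) auto
  then have "emeasure lebesgue {0..1::real} = 0"
    by (subst (asm) AE_iff_null_sets[symmetric]) auto
  then show False by simp
qed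

instance
proof
  show "(0::L0) \<noteq> 1"
    by transfer (simp add: eq_ae_def not_AE_halfline_False)
qed (transfer; simp add: eq_ae_def algebra_simps)+

end

lift_definition Linf_norm :: "L0 \<Rightarrow> ennreal" is
  "\<lambda>f. esssup halfline (\<lambda>x. ennreal \<bar>f x\<bar>)"
  unfolding eq_ae_def by (intro esssup_AE_cong) auto

lift_definition L1_norm :: "L0 \<Rightarrow> ennreal" is
  "\<lambda>f. \<integral>\<^sup>+ x. ennreal \<bar>f x\<bar> \<partial>halfline"
  unfolding eq_ae_def by (intro nn_integral_cong_AE) auto


section \<open>Sequences, with coordinatewise operations\<close>

text \<open>
  The ring structure on functions comes from \<^theory>\<open>HOL-Library.Function_Algebras\<close>.
\<close>

instantiation "fun" :: (type, scaleR) scaleR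
begin

definition scaleR_fun :: "real \<Rightarrow> ('a \<Rightarrow> 'b) \<Rightarrow> 'a \<Rightarrow> 'b" where
  "scaleR_fun c f = (\<lambda>x. c *\<^sub>R f x)"

instance ..

end

instance "fun" :: (type, real_vector) real_vector
  by standard (simp_all add: scaleR_fun_def fun_eq_iff scaleR_add_left scaleR_add_right)

instance "fun" :: (type, real_algebra) real_algebra
  by standard (simp_all add: scaleR_fun_def fun_eq_iff)

instance "fun" :: (type, real_algebra_1) real_algebra_1 ..

type_synonym Z0 = "nat \<Rightarrow> L0"

definition uniformly_null :: "Z0 \<Rightarrow> bool" where
  "uniformly_null f \<longleftrightarrow> (\<lambda>n. Linf_norm (f n)) \<longlonglongrightarrow> 0"

definition L1_null :: "Z0 \<Rightarrow> bool" where
  "L1_null f \<longleftrightarrow> (\<lambda>n. L1_norm (f n)) \<longlonglongrightarrow> 0"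


section \<open>Strong algebrability\<close>

definition real_subalgebra :: "'a::real_algebra set \<Rightarrow> bool" where
  "real_subalgebra M \<longleftrightarrow> 0 \<in> M \<and> (\<forall>x\<in>M. \<forall>y\<in>M. x + y \<in> M) \<and> (\<forall>x\<in>M. \<forall>y\<in>M. x * y \<in> M) \<and>
     (\<forall>c. \<forall>x\<in>M. c *\<^sub>R x \<in> M)"

text \<open>
  A real polynomial in the variables \<open>X\<^sub>0, \<dots>, X\<^sub>s\<^sub>-\<^sub>1\<close> is a finitely supported map sending each
  monomial to its coefficient, a monomial being the finitely supported map of its exponents.
\<close>

type_synonym real_mpoly = "(nat \<Rightarrow>\<^sub>0 nat) \<Rightarrow>\<^sub>0 real"

definition in_variables :: "nat \<Rightarrow> real_mpoly \<Rightarrow> bool" where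
  "in_variables s P \<longleftrightarrow> (\<forall>m \<in> Poly_Mapping.keys P. Poly_Mapping.keys m \<subseteq> {..<s})"

definition constant_term :: "real_mpoly \<Rightarrow> real" where
  "constant_term P = Poly_Mapping.lookup P 0"

definition mpoly_eval :: "real_mpoly \<Rightarrow> (nat \<Rightarrow> 'a) \<Rightarrow> 'a::{comm_ring_1, real_algebra_1}" where
  "mpoly_eval P f = (\<Sum>m \<in> Poly_Mapping.keys P. Poly_Mapping.lookup P m *\<^sub>R
     (\<Prod>i \<in> Poly_Mapping.keys m. f i ^ Poly_Mapping.lookup m i))"

definition free_generators :: "'a::{comm_ring_1, real_algebra_1} set \<Rightarrow> bool" where
  "free_generators B \<longleftrightarrow> (\<forall>s P f. in_variables s P \<longrightarrow> P \<noteq> 0 \<longrightarrow> constant_term P = 0 \<longrightarrow>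
     inj_on f {..<s} \<longrightarrow> f ` {..<s} \<subseteq> B \<longrightarrow> mpoly_eval P f \<noteq> 0)"

text \<open>
  The ambient algebra has a unit, but subalgebras need not contain it: the subalgebra
  generated by \<open>B\<close> consists of the values at elements of \<open>B\<close> of polynomials without constant term.
  The cardinal \<open>\<alpha>\<close> is given as a cardinal order.
\<close>

definition strongly_algebrable :: "'c rel \<Rightarrow> 'a::{comm_ring_1, real_algebra_1} set \<Rightarrow> bool" where
  "strongly_algebrable \<alpha> A \<longleftrightarrow>
     (\<exists>B. |B| =o \<alpha> \<and> free_generators B \<and> (real_subalgebra hull B) - {0} \<subseteq> A)"

abbreviation continuum :: "real rel" where
  "continuum \<equiv> |UNIV :: real set|"

end

theory Submission
  imports Defs "HOL-Real_Asymp.Real_Asymp"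
begin

unbundle asymp_equiv_syntax

text \<open>
  Sequences of constant functions suffice. If \<open>u\<close> is a real sequence and \<open>f\<^sub>n\<close> is the constant
  function \<open>u n\<close>, then \<open>f\<close> is uniformly null exactly when \<open>u\<close> tends to \<open>0\<close>, whereas the
  \<open>L\<^sup>1\<close>-norm of \<open>f\<^sub>n\<close> is infinite whenever \<open>u n\<close> is nonzero. So it is enough to find continuum many
  free generators in the algebra of real sequences such that every nonzero member of the
  generated subalgebra tends to \<open>0\<close> and is eventually nonzero.

  The generators are the sequences \<open>exp (- n powr t)\<close>, one for each real \<open>t > 0\<close>. A nontrivial
  monomial in them has the form \<open>exp (- w n)\<close>, where \<open>w\<close> is a linear combination of powers
  \<open>n powr t\<close> and tends to infinity. A nontrivial combination of distinct powers is asymptotic to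
  its term with the largest exponent, hence tends to plus or minus infinity
  (\<open>power_sum_unbounded\<close>). This has two consequences. First, distinct monomials
  are distinct sequences (\<open>inj_on_monomial_rate\<close>). Secondly, of any two distinct sequences of the
  form \<open>exp (- w n)\<close> one is negligible against the other, so a nontrivial linear combination
  of them is again asymptotic to one of its terms and is eventually nonzero
  (\<open>decay_sum_eventually_nonzero\<close>). Together they give freeness
  (\<open>free_generators_power_decays\<close>). Since the sequences \<open>exp (- w n)\<close> are closed under products,
  their span is a subalgebra. It contains the generated one, and all its members
  tend to \<open>0\<close> (\<open>decay_span_tendsto_0\<close>) and are zero or eventually nonzero
  (\<open>decay_span_eventually_nonzero\<close>).
\<close>

section \<open>Sequences of constant functions\<close>

definition const_seq :: "(nat \<Rightarrow> real) \<Rightarrow> Z0" where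
  "const_seq u = (\<lambda>n. of_real (u n))"

lemma emeasure_halfline: "emeasure halfline {0..} = \<infinity>"
proof -
  have "of_nat n \<le> emeasure lebesgue {0::real..}" for n
  proof -
    have "of_nat n = emeasure lebesgue {0..real n}"
      by (simp add: ennreal_of_nat_eq_real_of_nat)
    also have "\<dots> \<le> emeasure lebesgue {0::real..}"
      by (intro emeasure_mono) auto
    finally show ?thesis .
  qed
  then have "emeasure lebesgue {0::real..} = top"
    using ennreal_SUP_of_nat_eq_top by (metis SUP_least top.extremum_unique)
  then show ?thesis
    by (simp add: emeasure_restrict_space space_restrict_space)
qed

lemma Linf_norm_of_real: "Linf_norm (of_real c) = ennreal \<bar>c\<bar>"
  unfolding of_real_def
  by transfer (simp add: esssup_const emeasure_halfline space_restrict_space)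

text \<open>
  The half-line has infinite measure, so the \<open>L\<^sup>1\<close>-norm only sees whether a constant vanishes,
  however small the constant is.
\<close>

lemma L1_norm_of_real: "L1_norm (of_real c) = (if c = 0 then 0 else \<infinity>)"
  unfolding of_real_def
  by transfer (simp add: emeasure_halfline ennreal_mult_top)

lemma uniformly_null_const_seq: "uniformly_null (const_seq u) \<longleftrightarrow> u \<longlonglongrightarrow> 0"
  unfolding uniformly_null_def const_seq_def Linf_norm_of_real
  using tendsto_ennreal_iff[of "\<lambda>n. \<bar>u n\<bar>" sequentially 0]
  by (simp add: tendsto_rabs_zero_iff)

lemma not_L1_null_const_seq:
  assumes "frequently (\<lambda>n. u n \<noteq> 0) sequentially"
  shows "\<not> L1_null (const_seq u)"
proof
  assume "L1_null (const_seq u)"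
  then have "eventually (\<lambda>n. L1_norm (of_real (u n)) < 1) sequentially"
    unfolding L1_null_def const_seq_def by (rule order_tendstoD) simp
  then have "eventually (\<lambda>n. u n = 0) sequentially"
    by eventually_elim (auto simp: L1_norm_of_real split: if_splits)
  with assms show False by (simp add: frequently_def)
qed

section \<open>Reduction to real sequences\<close>

lemma mpoly_eval_cong:
  assumes "in_variables s P" "\<And>i. i < s \<Longrightarrow> f i = g i"
  shows "mpoly_eval P f = mpoly_eval P g"
  unfolding mpoly_eval_def using assms
  by (intro sum.cong prod.cong arg_cong2[of _ _ _ _ "(*\<^sub>R)"] refl) (auto simp: in_variables_def subset_iff)

text \<open>
  The operations on sequences are coordinatewise and the constants form a copy of the reals, so the
  next two lemmas turn the value of a polynomial at sequences of constants into a sequence of real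
  values of that polynomial.
\<close>

lemma mpoly_eval_apply: "mpoly_eval P F x = mpoly_eval P (\<lambda>i. F i x)"
  for F :: "nat \<Rightarrow> 'b \<Rightarrow> 'a::{comm_ring_1, real_algebra_1}"
proof -
  have sum: "(\<Sum>i\<in>A. g i) x = (\<Sum>i\<in>A. g i x)" for A and g :: "'c \<Rightarrow> 'b \<Rightarrow> 'a"
    by (induction A rule: infinite_finite_induct) auto
  have power: "(h ^ k) x = h x ^ k" for h :: "'b \<Rightarrow> 'a" and k
    by (induction k) auto
  have prod: "(\<Prod>i\<in>A. g i) x = (\<Prod>i\<in>A. g i x)" for A and g :: "'c \<Rightarrow> 'b \<Rightarrow> 'a"
    by (induction A rule: infinite_finite_induct) auto
  show ?thesis
    by (simp add: mpoly_eval_def sum prod power scaleR_fun_def)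
qed

lemma mpoly_eval_of_real: "mpoly_eval P (\<lambda>i. of_real (u i)) = of_real (mpoly_eval P u)"
  by (simp add: mpoly_eval_def scaleR_conv_of_real)

lemma inj_const_seq: "inj const_seq"
  by (auto simp: inj_def const_seq_def fun_eq_iff)

lemma real_subalgebra_const_seq:
  assumes "real_subalgebra M"
  shows "real_subalgebra (const_seq ` M)"
proof -
  have add: "const_seq u + const_seq v = const_seq (u + v)" for u v
    by (auto simp: const_seq_def fun_eq_iff)
  have mult: "const_seq u * const_seq v = const_seq (u * v)" for u v
    by (auto simp: const_seq_def fun_eq_iff)
  have scale: "c *\<^sub>R const_seq u = const_seq (c *\<^sub>R u)" for c u
    by (auto simp: const_seq_def fun_eq_iff scaleR_fun_def scaleR_conv_of_real)
  have "0 = const_seq 0"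
    by (auto simp: const_seq_def fun_eq_iff)
  with assms show ?thesis
    by (auto simp: real_subalgebra_def add mult scale)
qed

text \<open>
  This bounds generated subalgebras from above without expanding their elements as polynomials
  in the generators.
\<close>

lemma real_subalgebra_span:
  fixes E :: "'a::real_algebra set"
  assumes "\<And>x y. x \<in> E \<Longrightarrow> y \<in> E \<Longrightarrow> x * y \<in> E"
  shows "real_subalgebra (span E)"
proof -
  have "x * y \<in> span E" if x: "x \<in> span E" and y: "y \<in> span E" for x y
    using x
  proof (induction rule: span_induct_alt)
    case (step c a b)
    have "a * y \<in> span E"
      using y
    proof (induction rule: span_induct_alt)
      case (step c' a' b')
      then show ?case
        by (simp add: distrib_left assms \<open>a \<in> E\<close> span_add span_base span_scale)
    qed (simp add: span_zero)
    then show ?case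
      using step by (simp add: distrib_right span_add span_scale)
  qed (simp add: span_zero)
  then show ?thesis
    by (auto simp: real_subalgebra_def span_zero span_add span_scale)
qed

lemma span_nonzero_expansion:
  assumes "x \<in> span B" "x \<noteq> 0"
  obtains T c where "finite T" "T \<noteq> {}" "T \<subseteq> B" "\<forall>v\<in>T. c v \<noteq> 0" "x = (\<Sum>v\<in>T. c v *\<^sub>R v)"
proof -
  obtain c where c: "{v. c v \<noteq> 0} \<subseteq> B" "finite {v. c v \<noteq> 0}" "x = (\<Sum>v | c v \<noteq> 0. c v *\<^sub>R v)"
    using assms(1) unfolding span_alt by blast
  moreover from this assms(2) have "{v. c v \<noteq> 0} \<noteq> {}" by force
  ultimately show ?thesis using that[of "{v. c v \<noteq> 0}" c] by blast
qed

lemma sum_scaleR_apply: "(\<Sum>i\<in>I. c i *\<^sub>R g i) n = (\<Sum>i\<in>I. c i * g i n)"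
  for g :: "'i \<Rightarrow> 'a \<Rightarrow> real"
  by (induction I rule: infinite_finite_induct) (auto simp: scaleR_fun_def)

section \<open>Dominant terms\<close>

text \<open>
  Pairwise comparability under little-o ranks the terms, and the largest one swallows
  the others. Adding one term to a sum with known dominant term either leaves that term dominant
  or replaces it, so no maximum has to be chosen beforehand. The lemma serves twice below: for
  combinations of powers of \<open>n\<close>, and for combinations of exponentials of such combinations.
\<close>

lemma sum_asymp_equiv_term:
  fixes h :: "'i \<Rightarrow> 'a \<Rightarrow> real"
  assumes "finite I" "I \<noteq> {}"
    and "\<And>i j. i \<in> I \<Longrightarrow> j \<in> I \<Longrightarrow> i \<noteq> j \<Longrightarrow> h i \<in> o[F](h j) \<or> h j \<in> o[F](h i)"
  shows "\<exists>i\<in>I. (\<lambda>n. \<Sum>i\<in>I. h i n) \<sim>[F] h i"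
  using assms
proof (induction I rule: finite_ne_induct)
  case (insert j I)
  let ?s = "\<lambda>n. \<Sum>i\<in>I. h i n"
  obtain i where i: "i \<in> I" "?s \<sim>[F] h i"
    using insert.IH insert.prems by blast
  have "h j \<in> o[F](h i) \<or> h i \<in> o[F](h j)"
    using insert.prems insert.hyps i(1) by (metis insertCI)
  then show ?case
  proof
    assume "h j \<in> o[F](h i)"
    then have "(\<lambda>n. h j n + ?s n) \<sim>[F] h i"
      using i(2) by (simp add: asymp_equiv_simps)
    then show ?thesis using i(1) insert.hyps by auto
  next
    assume "h i \<in> o[F](h j)"
    then have "?s \<in> o[F](h j)"
      by (rule landau_o.big_small_trans[OF asymp_equiv_imp_bigo[OF i(2)]])
    then have "(\<lambda>n. h j n + ?s n) \<sim>[F] h j"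
      by (simp add: asymp_equiv_simps)
    then show ?thesis using insert.hyps by auto
  qed
qed auto

section \<open>Combinations of powers\<close>

definition power_seq :: "real \<Rightarrow> nat \<Rightarrow> real" where
  "power_seq t n = real n powr t"

lemma power_seq_at_top:
  assumes "0 < t"
  shows "filterlim (power_seq t) at_top sequentially"
  unfolding power_seq_def[abs_def]
  using assms by real_asymp

lemma power_seq_smallo:
  assumes "t < t'" "d \<noteq> 0"
  shows "(\<lambda>n. c * power_seq t n) \<in> o(\<lambda>n. d * power_seq t' n)"
proof -
  have "power_seq t \<in> o(power_seq t')"
    using assms(1) powr_smallo_iff[OF filterlim_real_sequentially]
    by (simp add: power_seq_def[abs_def])
  then show ?thesis
    using assms(2) by (cases "c = 0") auto
qed

text \<open>
  The term with the largest exponent dominates, and its coefficient decides the sign of the limit.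
  In particular the powers are linearly independent, which is what separates distinct monomials in
  the generators.
\<close>

lemma power_sum_unbounded:
  assumes "finite I" "I \<noteq> {}" "inj_on t I"
    and pos: "\<And>i. i \<in> I \<Longrightarrow> 0 < t i" and nz: "\<And>i. i \<in> I \<Longrightarrow> d i \<noteq> 0"
  defines "w \<equiv> (\<lambda>n. \<Sum>i\<in>I. d i * power_seq (t i) n)"
  shows "filterlim w at_top sequentially \<or> filterlim (\<lambda>n. - w n) at_top sequentially"
proof -
  have "\<exists>i\<in>I. w \<sim>[sequentially] (\<lambda>n. d i * power_seq (t i) n)"
    unfolding w_def
  proof (rule sum_asymp_equiv_term)
    fix i j assume "i \<in> I" "j \<in> I" "i \<noteq> j"
    then show "(\<lambda>n. d i * power_seq (t i) n) \<in> o(\<lambda>n. d j * power_seq (t j) n) \<or>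
      (\<lambda>n. d j * power_seq (t j) n) \<in> o(\<lambda>n. d i * power_seq (t i) n)"
      using power_seq_smallo[OF _ nz] inj_onD[OF \<open>inj_on t I\<close>]
      by (cases "t i" "t j" rule: linorder_cases) auto
  qed fact+
  then obtain i where i: "i \<in> I" and equiv: "w \<sim>[sequentially] (\<lambda>n. d i * power_seq (t i) n)"
    by blast
  have top: "filterlim (power_seq (t i)) at_top sequentially"
    using pos[OF i] by (rule power_seq_at_top)
  consider "d i > 0" | "- d i > 0" using nz[OF i] by linarith
  then show ?thesis
  proof cases
    case 1
    then have "filterlim (\<lambda>n. d i * power_seq (t i) n) at_top sequentially"
      using filterlim_tendsto_pos_mult_at_top[OF tendsto_const _ top] by simp
    with equiv show ?thesis
      by (metis asymp_equiv_at_top_transfer asymp_equiv_symI)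
  next
    case 2
    from filterlim_tendsto_pos_mult_at_top[OF tendsto_const this top]
    have "filterlim (\<lambda>n. - d i * power_seq (t i) n) at_top sequentially" .
    moreover have "(\<lambda>n. - w n) \<sim>[sequentially] (\<lambda>n. - d i * power_seq (t i) n)"
      using asymp_equiv_uminus[OF equiv] by simp
    ultimately show ?thesis
      by (metis asymp_equiv_at_top_transfer asymp_equiv_symI)
  qed
qed

lemma power_span_unbounded:
  assumes "w \<in> span (power_seq ` {0<..})" "w \<noteq> 0"
  shows "filterlim w at_top sequentially \<or> filterlim (\<lambda>n. - w n) at_top sequentially"
proof -
  obtain T d where T: "finite T" "T \<noteq> {}" "T \<subseteq> power_seq ` {0<..}" "\<forall>v\<in>T. d v \<noteq> 0"
    and w: "w = (\<Sum>v\<in>T. d v *\<^sub>R v)"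
    by (rule span_nonzero_expansion[OF assms])
  from T(3) have "\<forall>v\<in>T. \<exists>t>0. v = power_seq t" by auto
  then obtain t where t: "\<And>v. v \<in> T \<Longrightarrow> 0 < t v" "\<And>v. v \<in> T \<Longrightarrow> v = power_seq (t v)"
    by metis
  have "inj_on t T"
    using t(2) by (metis inj_onI)
  moreover have "w = (\<lambda>n. \<Sum>v\<in>T. d v * power_seq (t v) n)"
    unfolding w fun_eq_iff sum_scaleR_apply using t(2) by (metis (no_types, lifting) sum.cong)
  ultimately show ?thesis
    using power_sum_unbounded[of T t d] T t(1) by simp
qed

section \<open>Combinations of exponentially decaying sequences\<close>

text \<open>
  Rates may have negative lower-order coefficients. Taking a full linear span makes
  the difference of two rates accessible to the lemma on spans of powers, while the divergence
  condition still forces exponentials to decay and is preserved by sums.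
\<close>

definition rates :: "(nat \<Rightarrow> real) set" where
  "rates = {w \<in> span (power_seq ` {0<..}). filterlim w at_top sequentially}"

definition decays :: "(nat \<Rightarrow> real) set" where
  "decays = (\<lambda>w n. exp (- w n)) ` rates"

lemma decaysE:
  assumes "u \<in> decays"
  obtains w where "w \<in> rates" "u = (\<lambda>n. exp (- w n))"
  using assms by (auto simp: decays_def)

lemma exp_uminus_smallo:
  assumes "filterlim (\<lambda>n. w n - w' n) at_top F" "d \<noteq> 0"
  shows "(\<lambda>n. c * exp (- w n)) \<in> o[F](\<lambda>n. d * exp (- w' n :: real))"
proof -
  have "((\<lambda>n. exp (- (w n - w' n))) \<longlongrightarrow> 0) F"
    using assms(1) by (intro filterlim_compose[OF exp_at_bot]) (simp add: filterlim_uminus_at_top del: minus_diff_eq)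
  then have "(\<lambda>n. exp (- w n)) \<in> o[F](\<lambda>n. exp (- w' n))"
    by (intro smalloI_tendsto) (simp_all flip: exp_diff add: algebra_simps)
  then show ?thesis
    using assms(2) by (cases "c = 0") auto
qed

text \<open>
  The quotient of two distinct decays is \<open>exp (w' - w)\<close> for distinct rates \<open>w\<close>, \<open>w'\<close>. As
  \<open>w - w'\<close> tends to plus or minus infinity, the decays are pairwise comparable, and a
  dominant term, which never vanishes, exists.
\<close>

lemma decay_sum_eventually_nonzero:
  assumes "finite I" "I \<noteq> {}" "inj_on g I" "g ` I \<subseteq> decays" and nz: "\<And>i. i \<in> I \<Longrightarrow> c i \<noteq> 0"
  shows "eventually (\<lambda>n. (\<Sum>i\<in>I. c i * g i n) \<noteq> 0) sequentially"
proof -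
  have "\<exists>i\<in>I. (\<lambda>n. \<Sum>i\<in>I. c i * g i n) \<sim>[sequentially] (\<lambda>n. c i * g i n)"
  proof (rule sum_asymp_equiv_term)
    fix i j assume ij: "i \<in> I" "j \<in> I" "i \<noteq> j"
    then have "g i \<in> decays" "g j \<in> decays" using assms(4) by auto
    then obtain w w' where w: "w \<in> rates" "g i = (\<lambda>n. exp (- w n))"
      and w': "w' \<in> rates" "g j = (\<lambda>n. exp (- w' n))"
      by (elim decaysE)
    have "w - w' \<noteq> 0"
      using w w' ij inj_onD[OF \<open>inj_on g I\<close>] by auto
    moreover have "w - w' \<in> span (power_seq ` {0<..})"
      using w(1) w'(1) span_diff[of w _ w'] by (simp add: rates_def)
    ultimately have "filterlim (\<lambda>n. w n - w' n) at_top sequentially \<or>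
        filterlim (\<lambda>n. w' n - w n) at_top sequentially"
      using power_span_unbounded[of "w - w'"] unfolding fun_diff_def by simp
    then show "(\<lambda>n. c i * g i n) \<in> o(\<lambda>n. c j * g j n) \<or> (\<lambda>n. c j * g j n) \<in> o(\<lambda>n. c i * g i n)"
      unfolding w(2) w'(2)
      using exp_uminus_smallo[OF _ nz[OF ij(2)]] exp_uminus_smallo[OF _ nz[OF ij(1)]] by (rule disj_forward)
  qed fact+
  then obtain i where i: "i \<in> I" "(\<lambda>n. \<Sum>i\<in>I. c i * g i n) \<sim>[sequentially] (\<lambda>n. c i * g i n)"
    by blast
  from i(1) assms(4) have "g i \<in> decays" by auto
  then obtain w where "g i = (\<lambda>n. exp (- w n))" by (rule decaysE)
  with nz[OF i(1)] have "c i * g i n \<noteq> 0" for n by simp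
  then show ?thesis
    using asymp_equiv_eventually_zeros[OF i(2)] by (auto elim: eventually_mono)
qed

lemma decay_span_eventually_nonzero:
  assumes "u \<in> span decays" "u \<noteq> 0"
  shows "eventually (\<lambda>n. u n \<noteq> 0) sequentially"
proof -
  obtain T c where "finite T" "T \<noteq> {}" "T \<subseteq> decays" "\<forall>v\<in>T. c v \<noteq> 0"
    and u: "u = (\<Sum>v\<in>T. c v *\<^sub>R v)"
    by (rule span_nonzero_expansion[OF assms])
  then show ?thesis
    using decay_sum_eventually_nonzero[of T "\<lambda>v. v" c] unfolding u sum_scaleR_apply by simp
qed

lemma decay_span_tendsto_0:
  assumes "u \<in> span decays"
  shows "u \<longlonglongrightarrow> 0"
  using assms
proof (induction rule: span_induct_alt)
  case base
  show ?case by (simp add: zero_fun_def)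
next
  case (step c e v)
  from step.hyps(1) obtain w where w: "w \<in> rates" "e = (\<lambda>n. exp (- w n))"
    by (rule decaysE)
  then have "e \<longlonglongrightarrow> 0"
    by (auto intro!: filterlim_compose[OF exp_at_bot] simp: rates_def filterlim_uminus_at_top)
  with step show ?case
    by (auto simp: plus_fun_def scaleR_fun_def intro!: tendsto_eq_intros)
qed

lemma decays_mult:
  assumes "u \<in> decays" "v \<in> decays"
  shows "u * v \<in> decays"
proof -
  obtain w w' where w: "w \<in> rates" "u = (\<lambda>n. exp (- w n))" "w' \<in> rates" "v = (\<lambda>n. exp (- w' n))"
    using assms by (elim decaysE)
  then have "w + w' \<in> rates"
    using span_add[of w _ w'] by (auto simp: rates_def plus_fun_def intro: filterlim_at_top_add_at_top)
  moreover have "u * v = (\<lambda>n. exp (- (w + w') n))"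
    using w by (simp add: fun_eq_iff flip: exp_add)
  ultimately show ?thesis unfolding decays_def by (intro image_eqI)
qed

section \<open>The generators\<close>

definition power_decay :: "real \<Rightarrow> nat \<Rightarrow> real" where
  "power_decay t n = exp (- power_seq t n)"

lemma power_decay_in_decays: "0 < t \<Longrightarrow> power_decay t \<in> decays"
proof -
  assume t: "0 < t"
  then have "power_seq t \<in> rates"
    by (auto simp: rates_def power_seq_at_top intro!: span_base)
  then show ?thesis by (auto simp: decays_def power_decay_def[abs_def])
qed

lemma inj_power_decay: "inj power_decay"
proof (rule injI)
  fix s t assume "power_decay s = power_decay t"
  \<comment> \<open>At \<open>n = 0\<close> and \<open>n = 1\<close> the power does not determine the exponent; \<open>n = 2\<close> does.\<close>
  then have "power_decay s 2 = power_decay t 2" by simp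
  then show "s = t" by (simp add: power_decay_def power_seq_def powr_inj)
qed

text \<open>
  A monomial in the generators turns into a sum in the exponent, so it is again
  a decay; its rate is the following one.
\<close>

definition monomial_rate :: "(nat \<Rightarrow>\<^sub>0 nat) \<Rightarrow> (nat \<Rightarrow> real) \<Rightarrow> nat \<Rightarrow> real" where
  "monomial_rate m t n = (\<Sum>i\<in>Poly_Mapping.keys m. real (Poly_Mapping.lookup m i) * power_seq (t i) n)"

lemma power_decay_monomial:
  "(\<Prod>i\<in>Poly_Mapping.keys m. power_decay (t i) n ^ Poly_Mapping.lookup m i) = exp (- monomial_rate m t n)"
  by (simp add: power_decay_def monomial_rate_def exp_sum sum_negf[symmetric] exp_of_nat_mult[symmetric])

text \<open>
  The combination of powers is nonnegative, so of the two possible limits only plus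
  infinity remains. The trivial monomial has rate \<open>0\<close>; it is absent from polynomials without
  constant term.
\<close>

lemma monomial_rate_in_rates:
  assumes "m \<noteq> 0" "inj_on t (Poly_Mapping.keys m)" "\<And>i. i \<in> Poly_Mapping.keys m \<Longrightarrow> 0 < t i"
  shows "monomial_rate m t \<in> rates"
proof -
  let ?w = "monomial_rate m t"
  have "?w = (\<Sum>i\<in>Poly_Mapping.keys m. real (Poly_Mapping.lookup m i) *\<^sub>R power_seq (t i))"
    by (simp add: fun_eq_iff sum_scaleR_apply monomial_rate_def)
  then have span: "?w \<in> span (power_seq ` {0<..})"
    using assms(3) by (simp add: span_sum span_scale span_base)
  have "0 \<le> ?w n" for n
    by (auto simp: monomial_rate_def power_seq_def intro!: sum_nonneg)
  then have "\<not> eventually (\<lambda>n. 0 < - ?w n) sequentially"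
    by (auto simp: eventually_sequentially not_less)
  then have "\<not> filterlim (\<lambda>n. - ?w n) at_top sequentially"
    unfolding filterlim_at_top_dense by blast
  moreover have "filterlim ?w at_top sequentially \<or> filterlim (\<lambda>n. - ?w n) at_top sequentially"
    unfolding monomial_rate_def[abs_def]
    by (rule power_sum_unbounded) (use assms in \<open>auto simp: in_keys_iff\<close>)
  ultimately show ?thesis
    using span by (simp add: rates_def)
qed

text \<open>
  If two monomials had the same rate, the differences of their exponents would give a nontrivial
  combination of distinct powers that vanishes identically, although such combinations are
  unbounded.
\<close>

lemma inj_on_monomial_rate:
  assumes "inj_on t {..<s}" "\<And>i. i < s \<Longrightarrow> 0 < t i"
  shows "inj_on (\<lambda>m. monomial_rate m t) {m. Poly_Mapping.keys m \<subseteq> {..<s}}"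
proof (rule inj_onI, rule ccontr)
  fix m m' :: "nat \<Rightarrow>\<^sub>0 nat"
  assume m: "m \<in> {m. Poly_Mapping.keys m \<subseteq> {..<s}}" and m': "m' \<in> {m. Poly_Mapping.keys m \<subseteq> {..<s}}"
    and eq: "monomial_rate m t = monomial_rate m' t" and ne: "m \<noteq> m'"
  define d where "d i = real (Poly_Mapping.lookup m i) - real (Poly_Mapping.lookup m' i)" for i
  define I where "I = {i. i < s \<and> d i \<noteq> 0}"
  have rate: "monomial_rate k t n = (\<Sum>i<s. real (Poly_Mapping.lookup k i) * power_seq (t i) n)"
    if "Poly_Mapping.keys k \<subseteq> {..<s}" for k n
    unfolding monomial_rate_def using that
    by (intro sum.mono_neutral_left) (auto simp: in_keys_iff)
  have zero: "(\<Sum>i\<in>I. d i * power_seq (t i) n) = 0" for n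
  proof -
    have "(\<Sum>i\<in>I. d i * power_seq (t i) n) = (\<Sum>i<s. d i * power_seq (t i) n)"
      by (intro sum.mono_neutral_left) (auto simp: I_def)
    also have "\<dots> = monomial_rate m t n - monomial_rate m' t n"
      using m m' by (simp add: rate d_def left_diff_distrib sum_subtractf)
    finally show ?thesis using eq by simp
  qed
  obtain i where i: "Poly_Mapping.lookup m i \<noteq> Poly_Mapping.lookup m' i"
    using ne by (auto simp: poly_mapping_eq_iff fun_eq_iff)
  then have "i \<in> Poly_Mapping.keys m \<union> Poly_Mapping.keys m'"
    by (auto simp: in_keys_iff)
  then have "i \<in> I"
    using m m' i by (auto simp: I_def d_def)
  then have "filterlim (\<lambda>n. \<Sum>i\<in>I. d i * power_seq (t i) n) at_top sequentially \<or>
      filterlim (\<lambda>n. - (\<Sum>i\<in>I. d i * power_seq (t i) n)) at_top sequentially"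
    using assms by (intro power_sum_unbounded) (auto simp: I_def intro: inj_on_subset)
  then have "filterlim (\<lambda>_. 0 :: real) at_top sequentially"
    by (simp add: zero)
  then have "eventually (\<lambda>_. 0 < (0::real)) sequentially"
    unfolding filterlim_at_top_dense by blast
  then show False by simp
qed

text \<open>
  Distinct monomials have distinct rates, hence take distinct decays as values. A nonzero polynomial
  without constant term thus becomes a nontrivial combination of distinct decays, which is eventually
  nonzero.
\<close>

lemma free_generators_power_decays: "free_generators (const_seq ` power_decay ` {0<..})"
  unfolding free_generators_def
proof (intro allI impI)
  fix s P and f :: "nat \<Rightarrow> Z0"
  assume P: "in_variables s P" "P \<noteq> 0" "constant_term P = 0"
    and inj: "inj_on f {..<s}" and f: "f ` {..<s} \<subseteq> const_seq ` power_decay ` {0<..}"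
  have "\<forall>i<s. \<exists>t>0. f i = const_seq (power_decay t)" using f by (auto simp: subset_iff)
  then obtain t where t: "\<And>i. i < s \<Longrightarrow> 0 < t i" "\<And>i. i < s \<Longrightarrow> f i = const_seq (power_decay (t i))"
    by metis
  have inj_t: "inj_on t {..<s}"
    using inj t(2) by (auto simp: inj_on_def)
  have keys: "Poly_Mapping.keys m \<subseteq> {..<s}" "m \<noteq> 0" if "m \<in> Poly_Mapping.keys P" for m
    using P that by (auto simp: in_variables_def constant_term_def in_keys_iff)
  define g where "g m n = exp (- monomial_rate m t n)" for m n
  have eval: "mpoly_eval P f n =
      of_real (\<Sum>m\<in>Poly_Mapping.keys P. Poly_Mapping.lookup P m * g m n)" for n
  proof -
    have "mpoly_eval P f n = mpoly_eval P (\<lambda>i. of_real (power_decay (t i) n))"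
      unfolding mpoly_eval_apply using t(2) by (intro mpoly_eval_cong[OF P(1)]) (simp add: const_seq_def)
    then show ?thesis
      by (simp add: mpoly_eval_of_real) (simp add: mpoly_eval_def power_decay_monomial g_def)
  qed
  have "eventually (\<lambda>n. (\<Sum>m\<in>Poly_Mapping.keys P. Poly_Mapping.lookup P m * g m n) \<noteq> 0) sequentially"
  proof (rule decay_sum_eventually_nonzero)
    have "inj_on (\<lambda>m. monomial_rate m t) (Poly_Mapping.keys P)"
      using inj_on_monomial_rate[OF inj_t t(1)] keys(1) by (auto simp: inj_on_def)
    then show "inj_on g (Poly_Mapping.keys P)"
      by (auto simp: inj_on_def g_def fun_eq_iff)
    show "g ` Poly_Mapping.keys P \<subseteq> decays"
    proof
      fix u assume "u \<in> g ` Poly_Mapping.keys P"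
      then obtain m where m: "m \<in> Poly_Mapping.keys P" "u = g m" by blast
      have "monomial_rate m t \<in> rates"
        using keys[OF m(1)] inj_t t(1) by (intro monomial_rate_in_rates) (auto intro: inj_on_subset)
      then show "u \<in> decays"
        by (auto simp: decays_def m(2) g_def[abs_def])
    qed
  qed (use P(2) in \<open>auto simp: in_keys_iff\<close>)
  then obtain n where "(\<Sum>m\<in>Poly_Mapping.keys P. Poly_Mapping.lookup P m * g m n) \<noteq> 0"
    by (auto simp: eventually_sequentially)
  then have "mpoly_eval P f n \<noteq> 0"
    unfolding eval of_real_eq_0_iff .
  then show "mpoly_eval P f \<noteq> 0" by auto
qed

theorem theorem4p1:
  shows "strongly_algebrable continuum {f :: Z0. uniformly_null f \<and> \<not> L1_null f}"
  unfolding strongly_algebrable_def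
proof (intro exI conjI)
  let ?B = "const_seq ` power_decay ` {0<..}"
  \<comment> \<open>The exponents range over the positive reals; \<open>exp\<close> reindexes them by all reals.\<close>
  have "bij_betw (exp :: real \<Rightarrow> real) UNIV {0<..}"
    by (rule bij_betw_byWitness[where f' = ln]) auto
  moreover have "bij_betw (const_seq \<circ> power_decay) {0<..} ?B"
    using inj_const_seq inj_power_decay by (auto simp: bij_betw_def inj_on_def image_comp)
  ultimately have "bij_betw ((const_seq \<circ> power_decay) \<circ> exp) (UNIV :: real set) ?B"
    by (rule bij_betw_trans)
  then show "|?B| =o continuum"
    using card_of_ordIsoI ordIso_symmetric by blast
  show "free_generators ?B" by (rule free_generators_power_decays)
  show "(real_subalgebra hull ?B) - {0} \<subseteq> {f. uniformly_null f \<and> \<not> L1_null f}"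
  proof
    fix x assume x: "x \<in> (real_subalgebra hull ?B) - {0}"
    \<comment> \<open>The span of the decays is closed under products because sums of rates are rates.\<close>
    have "real_subalgebra hull ?B \<subseteq> const_seq ` span decays"
    proof (rule hull_minimal)
      show "?B \<subseteq> const_seq ` span decays"
        using power_decay_in_decays span_base by blast
      show "real_subalgebra (const_seq ` span decays)"
        by (intro real_subalgebra_const_seq real_subalgebra_span decays_mult)
    qed
    with x obtain u where u: "u \<in> span decays" "x = const_seq u" by blast
    have "u \<noteq> 0"
      using x u(2) by (auto simp: const_seq_def fun_eq_iff)
    then have "frequently (\<lambda>n. u n \<noteq> 0) sequentially"
      using decay_span_eventually_nonzero[OF u(1)] by (simp add: eventually_frequently)
    then show "x \<in> {f. uniformly_null f \<and> \<not> L1_null f}"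
      using u decay_span_tendsto_0 by (simp add: uniformly_null_const_seq not_L1_null_const_seq)
  qed
qed

end
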